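(* Let $u,v$ be real numbers with $u\ge v>0$. Then there exists an irrational number $\alpha>0$ with $\mu(\alpha)=1+\frac{u}{v}$ such that for every sine-like function $\mathcal{P}$ with period $\alpha$, the sequence $\mathcal{A}_{u,v}(n)=\frac{1}{n^{u}\mathcal{P}(n)^{v}}$ does not converge and the series $\sum_{n=1}^{\infty}\mathcal{A}_{u,v}(n)$ diverges.
   Context: A function $\mathcal{P}:\mathbb{R}\to[0,\infty)$ is called sine-like with (irrational) period $\alpha>0$ if (1) $\mathcal{P}(x)=\mathcal{P}(x+n\alpha)$ for all real $x$ and all integers $n$, and (2) there are constants $0<B_1\le B_2$ such that $B_1|x|\le\mathcal{P}(x)\le B_2|x|$ whenever $|x|\le\alpha/2$. Since $\alpha$ is irrational, $\mathcal{P}(n)>0$ for every positive integer $n$. $\mu(\alpha)$ denotes the irrationality measure of $\alpha$: the supremum of all $\mu_0>0$ such that $0<|\alpha-p/q|<q^{-\mu_0}$ has infinitely many integer solutions $(p,q)$ with $q\ge1$. *)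

theory Defs
  imports Complex_Main "HOL-Library.Extended_Real"
begin

definition sine_like :: "(real \<Rightarrow> real) \<Rightarrow> real \<Rightarrow> bool" where
  "sine_like P \<alpha> \<longleftrightarrow>
     \<alpha> > 0 \<and> \<alpha> \<notin> \<rat> \<and>
     (\<forall>x. P x \<ge> 0) \<and>
     (\<forall>x. \<forall>n::int. P x = P (x + of_int n * \<alpha>)) \<and>
     (\<exists>B1 B2. 0 < B1 \<and> B1 \<le> B2 \<and>
        (\<forall>x. \<bar>x\<bar> \<le> \<alpha> / 2 \<longrightarrow> B1 * \<bar>x\<bar> \<le> P x \<and> P x \<le> B2 * \<bar>x\<bar>))"

(* Extended-real valued: the supremum is infinite for Liouville numbers. *)
definition irrationality_measure :: "real \<Rightarrow> ereal" where
  "irrationality_measure \<alpha> =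
     Sup {ereal \<mu>\<^sub>0 | \<mu>\<^sub>0. \<mu>\<^sub>0 > 0 \<and>
       infinite {(p::int, q::int). q \<ge> 1 \<and>
         0 < \<bar>\<alpha> - of_int p / of_int q\<bar> \<and>
         \<bar>\<alpha> - of_int p / of_int q\<bar> < of_int q powr (- \<mu>\<^sub>0)}}"

(* Meaningful for n at least 1; the value at n = 0 is the artefact 1 / 0 = 0. *)
definition flint_hills_term :: "(real \<Rightarrow> real) \<Rightarrow> real \<Rightarrow> real \<Rightarrow> nat \<Rightarrow> real" where
  "flint_hills_term P u v n = 1 / (real n powr u * P (real n) powr v)"

end

theory Submission imports Defs "HOL-Real_Asymp.Real_Asymp" begin

text \<open>
  The number \<open>\<alpha>\<close> is the limit of an increasing sequence of fractions \<open>p\<^sub>k / q\<^sub>k\<close> with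
  \<open>p\<^sub>k\<^sub>+\<^sub>1 q\<^sub>k - p\<^sub>k q\<^sub>k\<^sub>+\<^sub>1 = 1\<close> (a continued fraction with minus signs) whose partial quotients are
  chosen such that \<open>q\<^sub>k\<^sub>+\<^sub>1\<close> lies between \<open>k q\<^sub>k\<^sup>w\<close> and \<open>(k + 7) q\<^sub>k\<^sup>w\<close>, where \<open>w = u / v\<close>. As
  \<open>\<alpha> - p\<^sub>k / q\<^sub>k\<close> is of order \<open>1 / (q\<^sub>k q\<^sub>k\<^sub>+\<^sub>1)\<close>, and \<open>k\<close> is at most logarithmic in \<open>q\<^sub>k\<close>, the
  irrationality measure is \<open>1 + w\<close>. The extra factor \<open>k\<close> makes \<open>p\<^sub>k\<^sup>u P(p\<^sub>k)\<^sup>v\<close> of order at most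
  \<open>k powr (- v)\<close>, so the terms at \<open>n = p\<^sub>k\<close> are unbounded.
\<close>

section \<open>Recurrences for the denominators and numerators\<close>

text \<open>The ceiling makes the product with \<open>q\<close> at least
  \<open>k * q powr w\<close>. The summand 5 outweighs the previous denominator that is later
  subtracted and forces geometric growth.\<close>

definition partial_quotient :: "real \<Rightarrow> nat \<Rightarrow> int \<Rightarrow> int" where
  "partial_quotient w k q = 5 + \<lceil>real k * real_of_int q powr (w - 1)\<rceil>"

fun denom :: "real \<Rightarrow> nat \<Rightarrow> int" where
  "denom w 0 = 1"
| "denom w (Suc 0) = 4"
| "denom w (Suc (Suc k)) =
     partial_quotient w (Suc k) (denom w (Suc k)) * denom w (Suc k) - denom w k"

fun numer :: "real \<Rightarrow> nat \<Rightarrow> int" where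
  "numer w 0 = 1"
| "numer w (Suc 0) = 5"
| "numer w (Suc (Suc k)) =
     partial_quotient w (Suc k) (denom w (Suc k)) * numer w (Suc k) - numer w k"

lemma partial_quotient_ge: "partial_quotient w k q \<ge> 5"
proof -
  have "(0::real) \<le> real k * real_of_int q powr (w - 1)" by simp
  then have "(0::int) \<le> \<lceil>real k * real_of_int q powr (w - 1)\<rceil>" by linarith
  then show ?thesis by (simp add: partial_quotient_def)
qed

text \<open>The two claims support each other in the induction: a quotient of at least 5, minus a
  previous denominator no larger than the current one, leaves the factor 4.\<close>

lemma denom_growth_aux: "denom w k > 0 \<and> denom w (Suc k) \<ge> 4 * denom w k"
proof (induction k)
  case (Suc k)
  have "5 * denom w (Suc k) \<le> partial_quotient w (Suc k) (denom w (Suc k)) * denom w (Suc k)"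
    using Suc by (intro mult_right_mono partial_quotient_ge) auto
  then have "4 * denom w (Suc k) \<le> denom w (Suc (Suc k))"
    using Suc unfolding denom.simps(3) by linarith
  with Suc show ?case by auto
qed auto

lemma denom_pos: "denom w k > 0"
  using denom_growth_aux by blast

lemma denom_growth: "denom w (Suc k) \<ge> 4 * denom w k"
  using denom_growth_aux by blast

lemma denom_ge_power: "denom w k \<ge> 4 ^ k"
proof (induction k)
  case (Suc k)
  then show ?case using denom_growth[of w k] by simp
qed auto

lemma strict_mono_denom: "strict_mono (denom w)"
  unfolding strict_mono_Suc_iff
proof
  fix k show "denom w k < denom w (Suc k)"
    using denom_growth[of w k] denom_pos[of w k] by linarith
qed

text \<open>Both sequences follow one recurrence whose step matrix has determinant 1, so the initial
  value \<open>5 * 1 - 1 * 4\<close> persists.\<close>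

lemma numer_denom_det: "numer w (Suc k) * denom w k - numer w k * denom w (Suc k) = 1"
proof (induction k)
  case (Suc k)
  then show ?case by (simp add: algebra_simps)
qed auto

text \<open>The subtracted denominator is absorbed by the surplus \<open>5 * q\<close>; for
  \<open>k = 0\<close> the left side vanishes.\<close>

lemma denom_Suc_lower: "real k * real_of_int (denom w k) powr w \<le> real_of_int (denom w (Suc k))"
proof (cases k)
  case (Suc j)
  define q where "q = real_of_int (denom w k)"
  define a where "a = real_of_int (partial_quotient w k (denom w k))"
  have q: "q > 0" using denom_pos by (simp add: q_def)
  have "real_of_int (denom w j) \<le> q"
    using strict_mono_less_eq[OF strict_mono_denom, of w j k] Suc by (simp add: q_def)
  moreover have "a \<ge> real k * q powr (w - 1) + 5"
    unfolding a_def q_def partial_quotient_def by simp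
  then have "(real k * q powr (w - 1) + 5) * q \<le> a * q"
    using q by (intro mult_right_mono) auto
  moreover have "(real k * q powr (w - 1) + 5) * q = real k * q powr w + 5 * q"
    using q by (simp add: powr_diff field_simps)
  moreover have "real_of_int (denom w (Suc k)) = a * q - real_of_int (denom w j)"
    using Suc by (simp add: a_def q_def)
  ultimately show ?thesis
    using q unfolding q_def[symmetric] by linarith
qed auto

text \<open>Rounding up costs at most one further \<open>q\<close>, and \<open>w \<ge> 1\<close>
  allows the linear term to be bounded by a multiple of \<open>q powr w\<close>.\<close>

lemma denom_Suc_upper:
  assumes "w \<ge> 1"
  shows "real_of_int (denom w (Suc k)) \<le> real (k + 7) * real_of_int (denom w k) powr w"
proof (cases k)
  case (Suc j)
  define q where "q = real_of_int (denom w k)"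
  define a where "a = real_of_int (partial_quotient w k (denom w k))"
  have q: "q \<ge> 1" using denom_pos[of w k] by (simp add: q_def)
  have "real_of_int (denom w j) \<ge> 0"
    using denom_pos[of w j] by simp
  moreover have "a \<le> real k * q powr (w - 1) + 6"
    unfolding a_def q_def partial_quotient_def by simp linarith
  then have "a * q \<le> (real k * q powr (w - 1) + 6) * q"
    using q by (intro mult_right_mono) auto
  moreover have "(real k * q powr (w - 1) + 6) * q = real k * q powr w + 6 * q"
    using q by (simp add: powr_diff field_simps)
  moreover have "q \<le> q powr w"
    using q assms powr_mono[of 1 w q] by simp
  moreover have "real_of_int (denom w (Suc k)) = a * q - real_of_int (denom w j)"
    using Suc by (simp add: a_def q_def)
  moreover have "real (k + 7) * q powr w = real k * q powr w + 7 * q powr w"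
    by (simp add: algebra_simps)
  ultimately show ?thesis
    using q unfolding q_def[symmetric] by linarith
qed auto

lemmas [simp del] = denom.simps(3) numer.simps(3)

section \<open>Convergents and their limit\<close>

definition conv_frac :: "real \<Rightarrow> nat \<Rightarrow> real" where
  "conv_frac w k = real_of_int (numer w k) / real_of_int (denom w k)"

lemma conv_frac_Suc:
  "conv_frac w (Suc k) = conv_frac w k + 1 / (real_of_int (denom w k) * real_of_int (denom w (Suc k)))"
proof -
  have "real_of_int (numer w (Suc k)) * real_of_int (denom w k)
      - real_of_int (numer w k) * real_of_int (denom w (Suc k)) = 1"
    using arg_cong[OF numer_denom_det[of w k], of real_of_int] by simp
  moreover have "real_of_int (denom w k) > 0" "real_of_int (denom w (Suc k)) > 0"
    using denom_pos[of w k] denom_pos[of w "Suc k"] by simp_all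
  ultimately show ?thesis by (simp add: conv_frac_def field_simps)
qed

lemma conv_frac_mono: "incseq (conv_frac w)"
  by (rule incseq_SucI)
     (simp add: conv_frac_Suc less_imp_le[OF denom_pos])

text \<open>The fraction rises by half of the old margin, and the new margin is at most the other
  half, because denominators two steps apart differ by a factor of at least 2.\<close>

lemma conv_frac_upper_antimono:
  "decseq (\<lambda>k. conv_frac w k + 2 / (real_of_int (denom w k) * real_of_int (denom w (Suc k))))"
proof (rule decseq_SucI)
  fix k
  define x y z where "x = real_of_int (denom w k)"
    and "y = real_of_int (denom w (Suc k))" and "z = real_of_int (denom w (Suc (Suc k)))"
  have pos: "x > 0" "y > 0" "z > 0" unfolding x_def y_def z_def using denom_pos by simp_all
  have "denom w (Suc (Suc k)) \<ge> 2 * denom w k"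
    using denom_growth[of w k] denom_growth[of w "Suc k"] denom_pos[of w k] by linarith
  then have "z \<ge> 2 * x" unfolding x_def z_def by linarith
  then have "2 * (x * y) \<le> y * z"
    using pos by (simp add: mult.commute mult.left_commute)
  then have "2 / (y * z) \<le> 2 / (2 * (x * y))"
    using pos by (intro divide_left_mono) auto
  also have "\<dots> = 2 / (x * y) - 1 / (x * y)" by (simp add: field_simps)
  finally show "conv_frac w (Suc k) + 2 / (real_of_int (denom w (Suc k)) * real_of_int (denom w (Suc (Suc k))))
      \<le> conv_frac w k + 2 / (real_of_int (denom w k) * real_of_int (denom w (Suc k)))"
    unfolding conv_frac_Suc[of w k] x_def[symmetric] y_def[symmetric] z_def[symmetric] by linarith
qed

text \<open>The supremum of a bounded increasing sequence is its limit; boundedness comes from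
  \<open>conv_frac_le_upper\<close>.\<close>

definition limit_number :: "real \<Rightarrow> real" where
  "limit_number w = (SUP k. conv_frac w k)"

text \<open>Both sides are compared at the index \<open>max j k\<close>, where the margin is
  nonnegative.\<close>

lemma conv_frac_le_upper:
  "conv_frac w j \<le> conv_frac w k + 2 / (real_of_int (denom w k) * real_of_int (denom w (Suc k)))"
proof -
  let ?r = "\<lambda>k. conv_frac w k + 2 / (real_of_int (denom w k) * real_of_int (denom w (Suc k)))"
  have "conv_frac w j \<le> conv_frac w (max j k)"
    by (rule incseqD[OF conv_frac_mono]) simp
  also have "\<dots> \<le> ?r (max j k)"
    by (simp add: less_imp_le[OF denom_pos])
  also have "\<dots> \<le> ?r k"
    by (rule decseqD[OF conv_frac_upper_antimono]) simp
  finally show ?thesis .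
qed

lemma limit_number_minus_conv_frac_le:
  "limit_number w - conv_frac w k \<le> 2 / (real_of_int (denom w k) * real_of_int (denom w (Suc k)))"
proof -
  have "limit_number w \<le> conv_frac w k + 2 / (real_of_int (denom w k) * real_of_int (denom w (Suc k)))"
    unfolding limit_number_def by (rule cSUP_least) (auto intro: conv_frac_le_upper)
  then show ?thesis by simp
qed

lemma conv_frac_less_limit_number: "conv_frac w k < limit_number w"
proof -
  have "conv_frac w k < conv_frac w (Suc k)"
    by (simp add: conv_frac_Suc denom_pos)
  also have "\<dots> \<le> limit_number w"
    unfolding limit_number_def
    by (rule cSUP_upper) (auto intro!: bdd_aboveI2 conv_frac_le_upper[of w _ 0])
  finally show ?thesis .
qed

text \<open>Half a period thus exceeds 1/2, which later keeps shifted arguments in the range of the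
  linear bounds on \<open>P\<close>.\<close>

lemma limit_number_gt_1: "limit_number w > 1"
  using conv_frac_less_limit_number[of w 0] by (simp add: conv_frac_def)

lemma limit_number_le_2: "limit_number w \<le> 2"
  using limit_number_minus_conv_frac_le[of w 0] by (simp add: conv_frac_def)

section \<open>Separation of fractions and irrationality\<close>

lemma abs_diff_fractions_ge:
  fixes a b c d :: int
  assumes "b > 0" "d > 0" "a * d \<noteq> c * b"
  shows "\<bar>of_int a / of_int b - of_int c / of_int d :: real\<bar> \<ge> 1 / (of_int b * of_int d)"
proof -
  have "\<bar>a * d - c * b\<bar> \<ge> 1" using assms by linarith
  then have "\<bar>real_of_int (a * d - c * b)\<bar> \<ge> 1" by linarith
  then have "1 / (of_int b * of_int d) \<le> \<bar>real_of_int (a * d - c * b)\<bar> / (of_int b * of_int d)"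
    using assms by (intro divide_right_mono) auto
  also have "\<dots> = \<bar>(real_of_int (a * d - c * b)) / (of_int b * of_int d)\<bar>"
    using assms by (simp add: abs_mult)
  also have "real_of_int (a * d - c * b) / (of_int b * of_int d) = of_int a / of_int b - of_int c / of_int d"
    using assms by (simp add: field_simps)
  finally show ?thesis .
qed

lemma denom_dominates: "\<exists>k. q < denom w k"
proof -
  have "(q::int) < 2 ^ nat q" 
    using of_nat_less_two_power[of "nat q", where ?'a = int] by (cases "q \<ge> 0") auto
  also have "\<dots> \<le> 4 ^ nat q" by (intro power_mono) auto
  also have "\<dots> \<le> denom w (nat q)" by (rule denom_ge_power)
  finally show ?thesis by blast
qed

text \<open>A rational limit with denominator \<open>b\<close> would differ from each convergent by
  at least \<open>1 / (b * denom w k)\<close>. The upper bound on that gap then forces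
  \<open>denom w (Suc k) \<le> 2 * b\<close>, false for large \<open>k\<close>.\<close>

lemma limit_number_irrational: "limit_number w \<notin> \<rat>"
proof
  assume "limit_number w \<in> \<rat>"
  then obtain a b :: int where b: "b > 0" and ab: "limit_number w = of_int a / of_int b"
    by (metis Rats_cases')
  obtain k where k: "2 * b < denom w k" using denom_dominates by blast
  have "denom w k < denom w (Suc k)" using strict_mono_denom by (simp add: strict_mono_Suc_iff)
  with k have k2: "2 * b < denom w (Suc k)" by linarith
  have ne: "a * denom w k \<noteq> numer w k * b"
  proof
    assume "a * denom w k = numer w k * b"
    then have "real_of_int a * real_of_int (denom w k) = real_of_int (numer w k) * real_of_int b"
      by (metis of_int_mult)
    then have "limit_number w = conv_frac w k"
      unfolding ab conv_frac_def using b denom_pos[of w k] by (simp add: field_simps)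
    then show False using conv_frac_less_limit_number[of w k] by simp
  qed
  have "1 / (of_int b * of_int (denom w k)) \<le> \<bar>limit_number w - conv_frac w k\<bar>"
    unfolding ab conv_frac_def using abs_diff_fractions_ge[OF b denom_pos ne] .
  also have "\<dots> \<le> 2 / (real_of_int (denom w k) * real_of_int (denom w (Suc k)))"
    using limit_number_minus_conv_frac_le[of w k] conv_frac_less_limit_number[of w k] by simp
  finally have "real_of_int (denom w (Suc k)) \<le> 2 * of_int b"
    using b denom_pos[of w k] denom_pos[of w "Suc k"] by (simp add: field_simps)
  then show False using k2 by linarith
qed

text \<open>The fraction \<open>p / q\<close> differs from the convergent of index
  \<open>Suc k\<close> by at least \<open>1 / (q * denom w (Suc k))\<close>, and the limit is so
  near that convergent that at most half of this distance is lost.\<close>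

lemma limit_number_approx_lower:
  fixes p q :: int
  assumes q: "q \<ge> 1" "q < denom w (Suc k)"
  shows "1 / (2 * of_int q * of_int (denom w (Suc k))) \<le> \<bar>limit_number w - of_int p / of_int q\<bar>"
proof -
  define y z where "y = real_of_int (denom w (Suc k))" and "z = real_of_int (denom w (Suc (Suc k)))"
  define x where "x = real_of_int q"
  have "coprime (denom w (Suc k)) (numer w (Suc k))"
  proof (rule coprimeI)
    fix d assume "d dvd denom w (Suc k)" "d dvd numer w (Suc k)"
    then have "d dvd numer w (Suc k) * denom w k - numer w k * denom w (Suc k)" by simp
    then show "is_unit d" by (simp add: numer_denom_det)
  qed
  \<comment> \<open>Equality would make \<open>denom w (Suc k)\<close> divide the smaller positive
    number \<open>q\<close>.\<close>
  then have ne: "p * denom w (Suc k) \<noteq> numer w (Suc k) * q"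
    using q by (metis coprime_dvd_mult_right_iff dvd_triv_right zdvd_not_zless zero_less_one order_less_le_trans)
  have pos: "x > 0" "y > 0" "z > 0" 
    using q denom_pos by (simp_all add: x_def y_def z_def)
  have "1 / (x * y) \<le> \<bar>of_int p / of_int q - conv_frac w (Suc k)\<bar>"
    unfolding conv_frac_def x_def y_def
    using abs_diff_fractions_ge[OF _ denom_pos ne] q by simp
  moreover have "\<bar>limit_number w - conv_frac w (Suc k)\<bar> \<le> 2 / (y * z)"
    unfolding y_def z_def using limit_number_minus_conv_frac_le[of w "Suc k"] 
      conv_frac_less_limit_number[of w "Suc k"] by simp
  moreover have "2 / (y * z) \<le> 2 / (4 * (x * y))"
  proof (rule divide_left_mono)
    have "4 * q \<le> denom w (Suc (Suc k))" using q denom_growth[of w "Suc k"] by linarith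
    then have "4 * x \<le> z" unfolding x_def z_def by linarith
    then show "4 * (x * y) \<le> y * z" using pos by (simp add: mult.commute mult.left_commute)
  qed (use pos in auto)
  moreover have "2 / (4 * (x * y)) = 1 / (x * y) - 1 / (2 * x * y)"
    using pos by (simp add: field_simps)
  ultimately show ?thesis
    unfolding x_def[symmetric] y_def[symmetric] by linarith
qed

text \<open>For \<open>k = 0\<close> the right side would be 0 by the convention for division, hence
  the assumption.\<close>

lemma limit_number_approx_upper:
  assumes "k > 0"
  shows "\<bar>limit_number w - conv_frac w k\<bar> \<le> 2 / (real k * real_of_int (denom w k) powr (1 + w))"
proof -
  have d: "real_of_int (denom w k) > 0" using denom_pos by simp
  have "\<bar>limit_number w - conv_frac w k\<bar> \<le> 2 / (real_of_int (denom w k) * real_of_int (denom w (Suc k)))"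
    using limit_number_minus_conv_frac_le[of w k] conv_frac_less_limit_number[of w k] by simp
  also have "\<dots> \<le> 2 / (real_of_int (denom w k) * (real k * real_of_int (denom w k) powr w))"
    using d assms denom_Suc_lower[of k w] denom_pos[of w "Suc k"]
    by (intro divide_left_mono mult_left_mono mult_pos_pos) auto
  also have "\<dots> = 2 / (real k * real_of_int (denom w k) powr (1 + w))"
    using d by (simp add: powr_add algebra_simps)
  finally show ?thesis .
qed

section \<open>Irrationality measure\<close>

text \<open>Bounded denominators and bounded distance from \<open>\<alpha>\<close> bound the
  numerators too.\<close>

lemma finite_fractions_near:
  fixes \<alpha> :: real
  assumes "\<And>p q. (p, q) \<in> S \<Longrightarrow> q \<ge> 1 \<and> q < N \<and> \<bar>\<alpha> - of_int p / of_int q\<bar> < 1"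
  shows "finite (S :: (int \<times> int) set)"
proof (rule finite_subset)
  define M where "M = \<lceil>(\<bar>\<alpha>\<bar> + 1) * of_int N\<rceil>"
  show "S \<subseteq> {-M..M} \<times> {1..N}"
  proof safe
    fix p q assume "(p, q) \<in> S"
    then have q: "q \<ge> 1" "q < N" "\<bar>\<alpha> - of_int p / of_int q\<bar> < 1" using assms by blast+
    then have "\<bar>of_int p / of_int q\<bar> \<le> \<bar>\<alpha>\<bar> + 1" by linarith
    then have "\<bar>of_int p\<bar> \<le> (\<bar>\<alpha>\<bar> + 1) * of_int q" using q by (simp add: abs_divide field_simps)
    also have "\<dots> \<le> (\<bar>\<alpha>\<bar> + 1) * of_int N" using q by (intro mult_left_mono) auto
    also have "\<dots> \<le> of_int M" unfolding M_def by linarith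
    finally have "\<bar>p\<bar> \<le> M" by linarith
    then show "p \<in> {-M..M}" "q \<in> {1..N}" using q by auto
  qed
qed auto

text \<open>The convergents qualify from index 3 on, where the factor \<open>2 / k\<close> drops
  below 1; their denominators are pairwise distinct.\<close>

lemma infinite_approximations_limit_number:
  "infinite {(p::int, q::int). q \<ge> 1 \<and> 0 < \<bar>limit_number w - of_int p / of_int q\<bar> \<and>
     \<bar>limit_number w - of_int p / of_int q\<bar> < of_int q powr (- (1 + w))}" (is "infinite ?S")
proof
  assume "finite ?S"
  then have "finite (snd ` ?S)" by simp
  moreover have "denom w ` {3..} \<subseteq> snd ` ?S"
  proof safe
    fix k :: nat assume k: "k \<ge> 3"
    define Q where "Q = real_of_int (denom w k) powr (1 + w)"
    have Q: "Q > 0" using denom_pos[of w k] by (simp add: Q_def)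
    have "\<bar>limit_number w - conv_frac w k\<bar> \<le> 2 / (real k * Q)"
      unfolding Q_def using k by (intro limit_number_approx_upper) auto
    also have "\<dots> < 1 / Q" using k Q by (simp add: field_simps)
    also have "\<dots> = of_int (denom w k) powr (- (1 + w))"
      unfolding Q_def powr_minus by (simp add: divide_inverse)
    finally have "(numer w k, denom w k) \<in> ?S"
      using conv_frac_less_limit_number[of w k] denom_pos[of w k] by (simp add: conv_frac_def)
    then show "denom w k \<in> snd ` ?S" by force
  qed
  ultimately have "finite (denom w ` {3..})" by (rule rev_finite_subset)
  then have "finite {3::nat..}"
    by (rule finite_imageD) (meson strict_mono_denom strict_mono_imp_inj_on inj_on_subset subset_UNIV)
  then show False using infinite_Ici by blast
qed

text \<open>For \<open>q\<close> between consecutive denominators of index \<open>k\<close> and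
  \<open>Suc k\<close>, the lower bound on the distance forces
  \<open>q powr e < 2 * (k + 7)\<close>, where \<open>e\<close> is the excess of
  \<open>\<mu>\<close> over \<open>1 + w\<close>. Since \<open>q \<ge> 4 ^ k\<close>, only finitely
  many \<open>k\<close> remain.\<close>

lemma finite_approximations_limit_number:
  assumes w: "w \<ge> 1" and \<mu>: "\<mu> > 1 + w"
  shows "finite {(p::int, q::int). q \<ge> 1 \<and> 0 < \<bar>limit_number w - of_int p / of_int q\<bar> \<and>
     \<bar>limit_number w - of_int p / of_int q\<bar> < of_int q powr (- \<mu>)}" (is "finite ?S")
proof -
  define e where "e = \<mu> - (1 + w)"
  have e: "e > 0" using \<mu> by (simp add: e_def)
  then have "eventually (\<lambda>k. 2 * (real k + 7) < (4 powr real k) powr e) at_top"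
    by real_asymp
  then obtain K where K: "\<And>k. k \<ge> K \<Longrightarrow> 2 * (real k + 7) < (4 powr real k) powr e"
    unfolding eventually_at_top_linorder by blast
  show ?thesis
  proof (rule finite_fractions_near[of _ "denom w K" "limit_number w"])
    fix p q assume "(p, q) \<in> ?S"
    then have q: "q \<ge> 1" and S: "\<bar>limit_number w - of_int p / of_int q\<bar> < of_int q powr (- \<mu>)"
      by auto
    define x where "x = real_of_int q"
    have x: "x \<ge> 1" using q by (simp add: x_def)
    \<comment> \<open>Minimality yields \<open>denom w k \<le> q < denom w (Suc k)\<close>; the case
      \<open>k = 0\<close> uses \<open>denom w 0 = 1\<close>.\<close>
    define k where "k = (LEAST k. q < denom w (Suc k))"
    have ex: "\<exists>k. q < denom w (Suc k)"
      using denom_dominates[of q w] strict_mono_denom[of w]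
      by (meson less_trans strict_mono_Suc_iff)
    have k1: "q < denom w (Suc k)" unfolding k_def using ex by (rule LeastI_ex)
    have k2: "denom w k \<le> q"
    proof (cases k)
      case (Suc j)
      then have "\<not> q < denom w (Suc j)" using not_less_Least[of j "\<lambda>k. q < denom w (Suc k)"]
        by (simp add: k_def)
      then show ?thesis using Suc by simp
    qed (use q in auto)
    define D where "D = real_of_int (denom w k)"
    have D: "1 \<le> D" "D \<le> x" using k2 denom_pos[of w k] by (simp_all add: D_def x_def)
    have "1 / (2 * x * of_int (denom w (Suc k))) < x powr (- \<mu>)"
      using limit_number_approx_lower[OF q k1, of p] S unfolding x_def by linarith
    then have "x powr \<mu> < 2 * x * of_int (denom w (Suc k))"
      using x denom_pos[of w "Suc k"] by (simp add: powr_minus field_simps)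
    also have "\<dots> \<le> 2 * x * (real (k + 7) * D powr w)"
      unfolding D_def using x by (intro mult_left_mono denom_Suc_upper w) auto
    also have "\<dots> \<le> 2 * x * (real (k + 7) * x powr w)"
      using x D w by (intro mult_left_mono powr_mono2) auto
    also have "\<dots> = 2 * (real k + 7) * x powr (1 + w)"
      using x by (simp add: powr_add)
    finally have "x powr e * x powr (1 + w) < 2 * (real k + 7) * x powr (1 + w)"
      by (simp add: e_def flip: powr_add)
    then have "x powr e < 2 * (real k + 7)" using x by simp
    moreover have "(4 powr real k) powr e \<le> x powr e"
    proof (rule powr_mono2)
      have "4 powr real k = real_of_int (4 ^ k)" by (simp add: powr_realpow)
      also have "\<dots> \<le> D" unfolding D_def using denom_ge_power[of k w] by linarith
      finally show "4 powr real k \<le> x" using D by simp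
    qed (use e in auto)
    ultimately have "k < K" using K[of k] by (meson leI less_le_trans not_less_iff_gr_or_eq)
    then have "denom w (Suc k) \<le> denom w K"
      using strict_mono_less_eq[OF strict_mono_denom, of w "Suc k" K] by simp
    \<comment> \<open>This supplies the distance below 1 that \<open>finite_fractions_near\<close>
      demands.\<close>
    moreover have "x powr (- \<mu>) \<le> x powr 0" using x \<mu> w by (intro powr_mono) auto
    then have "x powr (- \<mu>) \<le> 1" using x by simp
    ultimately show "q \<ge> 1 \<and> q < denom w K \<and> \<bar>limit_number w - of_int p / of_int q\<bar> < 1"
      using q k1 S unfolding x_def by linarith
  qed
qed

text \<open>The exponent \<open>1 + w\<close> is itself admissible and no larger one is, so the
  supremum is attained.\<close>

lemma irrationality_measure_limit_number:
  assumes "w \<ge> 1"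
  shows "irrationality_measure (limit_number w) = ereal (1 + w)"
  unfolding irrationality_measure_def
proof (rule antisym)
  show "Sup {ereal \<mu>\<^sub>0 | \<mu>\<^sub>0. \<mu>\<^sub>0 > 0 \<and> infinite {(p::int, q::int). q \<ge> 1 \<and>
         0 < \<bar>limit_number w - of_int p / of_int q\<bar> \<and>
         \<bar>limit_number w - of_int p / of_int q\<bar> < of_int q powr (- \<mu>\<^sub>0)}} \<le> ereal (1 + w)"
  proof (rule Sup_least, clarify)
    fix \<mu> :: real
    assume "infinite {(p::int, q::int). q \<ge> 1 \<and> 0 < \<bar>limit_number w - of_int p / of_int q\<bar> \<and>
         \<bar>limit_number w - of_int p / of_int q\<bar> < of_int q powr (- \<mu>)}"
    then have "\<not> \<mu> > 1 + w" using finite_approximations_limit_number[OF assms] by blast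
    then show "ereal \<mu> \<le> ereal (1 + w)" by simp
  qed
  show "ereal (1 + w) \<le> Sup {ereal \<mu>\<^sub>0 | \<mu>\<^sub>0. \<mu>\<^sub>0 > 0 \<and> infinite {(p::int, q::int). q \<ge> 1 \<and>
         0 < \<bar>limit_number w - of_int p / of_int q\<bar> \<and>
         \<bar>limit_number w - of_int p / of_int q\<bar> < of_int q powr (- \<mu>\<^sub>0)}}"
    using infinite_approximations_limit_number[of w] assms by (intro Sup_upper) force
qed

section \<open>Size of the terms at the numerators\<close>

lemma numer_bounds: "0 < numer w k" "numer w k \<le> 2 * denom w k"
proof -
  have d: "real_of_int (denom w k) > 0" using denom_pos by simp
  have "conv_frac w 0 \<le> conv_frac w k" by (rule incseqD[OF conv_frac_mono]) simp
  then have "0 < conv_frac w k" by (simp add: conv_frac_def)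
  then show "0 < numer w k" using d by (simp add: conv_frac_def zero_less_divide_iff)
  have "conv_frac w k \<le> 2"
    using conv_frac_less_limit_number[of w k] limit_number_le_2[of w] by simp
  then show "numer w k \<le> 2 * denom w k" using d by (simp add: conv_frac_def field_simps)
qed

text \<open>Shifting the numerator by \<open>denom w k\<close> periods brings it within
  \<open>2 / denom w (Suc k)\<close> of 0, where the linear bounds on \<open>P\<close> apply. The
  lower one gives positivity, so the terms at these points are genuine reciprocals.\<close>

lemma sine_like_numer_bounds:
  assumes P: "sine_like P (limit_number w)"
  obtains B where "B > 0"
    "\<And>k. k > 0 \<Longrightarrow> 0 < P (of_int (numer w k)) \<and>
       P (of_int (numer w k)) \<le> B / (real k * real_of_int (denom w k) powr w)"
proof -
  define \<alpha> where "\<alpha> = limit_number w"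
  obtain B1 B2 where B: "0 < B1" "B1 \<le> B2"
    "\<And>x. \<bar>x\<bar> \<le> \<alpha> / 2 \<Longrightarrow> B1 * \<bar>x\<bar> \<le> P x \<and> P x \<le> B2 * \<bar>x\<bar>"
    using P unfolding sine_like_def \<alpha>_def by blast
  have per: "P x = P (x + of_int n * \<alpha>)" for x and n :: int
    using P unfolding sine_like_def \<alpha>_def by blast
  show ?thesis
  proof (rule that[of "2 * B2"])
    show "2 * B2 > 0" using B by simp
    fix k :: nat assume k: "k > 0"
    define D where "D = real_of_int (denom w k)"
    define x where "x = real_of_int (numer w k) + of_int (- denom w k) * \<alpha>"
    have D: "D > 0" using denom_pos by (simp add: D_def)
    have x: "x = - (D * (\<alpha> - conv_frac w k))"
      using D unfolding x_def conv_frac_def D_def by (simp add: field_simps)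
    have lt: "conv_frac w k < \<alpha>" unfolding \<alpha>_def by (rule conv_frac_less_limit_number)
    have ax: "\<bar>x\<bar> = D * (\<alpha> - conv_frac w k)"
      using x D lt by simp
    have "\<bar>x\<bar> \<le> D * (2 / (D * real_of_int (denom w (Suc k))))"
      unfolding ax using D limit_number_minus_conv_frac_le[of w k]
      by (intro mult_left_mono) (auto simp: D_def \<alpha>_def)
    also have "\<dots> = 2 / real_of_int (denom w (Suc k))" using D by simp
    finally have ub: "\<bar>x\<bar> \<le> 2 / real_of_int (denom w (Suc k))" .
    \<comment> \<open>\<open>denom w (Suc k) \<ge> 4\<close> and \<open>\<alpha> > 1\<close> place
      \<open>x\<close> within half a period of 0.\<close>
    also have "\<dots> \<le> 2 / 4"
      using denom_growth[of w k] denom_pos[of w k]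
      by (intro divide_left_mono) (simp, linarith, simp)
    also have "\<dots> \<le> \<alpha> / 2" using limit_number_gt_1[of w] by (simp add: \<alpha>_def)
    finally have Px: "B1 * \<bar>x\<bar> \<le> P x \<and> P x \<le> B2 * \<bar>x\<bar>" by (rule B(3))
    have "\<bar>x\<bar> > 0" using ax D lt by simp
    then have "0 < B1 * \<bar>x\<bar>" using B(1) by simp
    moreover have "B2 * \<bar>x\<bar> \<le> B2 * (2 / (real k * D powr w))"
    proof (rule mult_left_mono)
      have "2 / real_of_int (denom w (Suc k)) \<le> 2 / (real k * D powr w)"
        using D k denom_Suc_lower[of k w] denom_pos[of w "Suc k"]
        by (intro divide_left_mono) (auto simp: D_def)
      with ub show "\<bar>x\<bar> \<le> 2 / (real k * D powr w)" by linarith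
    qed (use B in auto)
    moreover have "P (of_int (numer w k)) = P x"
      unfolding x_def by (rule per)
    ultimately show "0 < P (of_int (numer w k)) \<and>
       P (of_int (numer w k)) \<le> 2 * B2 / (real k * real_of_int (denom w k) powr w)"
      using Px unfolding D_def by (auto simp: mult.commute)
  qed
qed

text \<open>The exponent \<open>w = u / v\<close> is chosen so that the powers of the denominator
  cancel; only the extra factor \<open>k\<close> survives, raised to the power
  \<open>v\<close>.\<close>

lemma flint_hills_term_numer_lower:
  assumes v: "v > 0" and u: "u > 0" and P: "sine_like P (limit_number (u / v))"
  obtains C where "C > 0"
    "\<And>k. k > 0 \<Longrightarrow> flint_hills_term P u v (nat (numer (u / v) k)) \<ge> C * real k powr v"
proof -
  define w where "w = u / v"
  obtain B where B: "B > 0"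
    "\<And>k. k > 0 \<Longrightarrow> 0 < P (of_int (numer w k)) \<and>
       P (of_int (numer w k)) \<le> B / (real k * real_of_int (denom w k) powr w)"
    using sine_like_numer_bounds[OF P[folded w_def]] by blast
  show ?thesis
  proof (rule that[of "1 / (2 powr u * B powr v)"])
    show "1 / (2 powr u * B powr v) > 0" using B by simp
    fix k :: nat assume k: "k > 0"
    define n where "n = real_of_int (numer w k)"
    define D where "D = real_of_int (denom w k)"
    have D: "D > 0" using denom_pos by (simp add: D_def)
    have n: "0 < n" "n \<le> 2 * D" using numer_bounds[of w k] unfolding n_def D_def by linarith+
    have Pn: "0 < P n" "P n \<le> B / (real k * D powr w)" using B(2)[OF k] by (auto simp: n_def D_def)
    have "n powr u * P n powr v \<le> (2 * D) powr u * (B / (real k * D powr w)) powr v"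
      using n Pn u v by (intro mult_mono powr_mono2) auto
    also have "\<dots> = 2 powr u * D powr u * (B powr v / (real k powr v * D powr (w * v)))"
      using D k B by (simp add: powr_mult powr_divide powr_powr)
    also have "w * v = u" using v by (simp add: w_def)
    also have "2 powr u * D powr u * (B powr v / (real k powr v * D powr u))
        = 2 powr u * B powr v / real k powr v"
      using D by simp
    finally have "1 / (2 powr u * B powr v / real k powr v) \<le> 1 / (n powr u * P n powr v)"
      using n Pn B k by (intro divide_left_mono) auto
    moreover have "real (nat (numer w k)) = n" using numer_bounds[of w k] by (simp add: n_def)
    ultimately show "flint_hills_term P u v (nat (numer (u / v) k)) \<ge> 1 / (2 powr u * B powr v) * real k powr v"
      unfolding w_def[symmetric] flint_hills_term_def by simp
  qed
qed

theorem theorem6: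
  fixes u v :: real
  assumes "u \<ge> v" and "v > 0"
  shows "\<exists>\<alpha>::real. \<alpha> > 0 \<and> \<alpha> \<notin> \<rat> \<and>
           irrationality_measure \<alpha> = ereal (1 + u / v) \<and>
           (\<forall>P. sine_like P \<alpha> \<longrightarrow>
              \<not> convergent (\<lambda>n. flint_hills_term P u v (Suc n)) \<and>
              \<not> summable (\<lambda>n. flint_hills_term P u v (Suc n)))"
proof (intro exI[of _ "limit_number (u / v)"] conjI allI impI)
  show "limit_number (u / v) > 0" using limit_number_gt_1[of "u / v"] by simp
  show "limit_number (u / v) \<notin> \<rat>" by (rule limit_number_irrational)
  show "irrationality_measure (limit_number (u / v)) = ereal (1 + u / v)"
    using assms by (intro irrationality_measure_limit_number) simp
  fix P assume P: "sine_like P (limit_number (u / v))"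
  \<comment> \<open>A convergent sequence is bounded, but the terms at the numerators exceed every
    bound.\<close>
  show nonconv: "\<not> convergent (\<lambda>n. flint_hills_term P u v (Suc n))"
  proof
    assume "convergent (\<lambda>n. flint_hills_term P u v (Suc n))"
    then obtain M where M: "\<And>n. norm (flint_hills_term P u v (Suc n)) \<le> M"
      using convergent_imp_Bseq BseqE by metis
    obtain C where C: "C > 0"
      "\<And>k. k > 0 \<Longrightarrow> flint_hills_term P u v (nat (numer (u / v) k)) \<ge> C * real k powr v"
      using flint_hills_term_numer_lower[OF _ _ P] assms
      by (metis less_le_trans)
    have "eventually (\<lambda>k. C * real k powr v > M) at_top"
      using C(1) assms(2) by real_asymp
    then obtain k where k: "k > 0" "C * real k powr v > M"
      using eventually_conj[OF eventually_gt_at_top[of 0]]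
        eventually_happens[of _ "at_top :: nat filter"] trivial_limit_sequentially by blast
    \<comment> \<open>The sequence is indexed through \<open>Suc\<close>, so the positive numerator
      is written as a successor.\<close>
    have "nat (numer (u / v) k) = Suc (nat (numer (u / v) k) - 1)"
      using numer_bounds(1)[of "u / v" k] by simp
    then have "flint_hills_term P u v (nat (numer (u / v) k)) \<le> M"
      using M[of "nat (numer (u / v) k) - 1"] by simp
    with C(2)[OF k(1)] k(2) show False by linarith
  qed
  show "\<not> summable (\<lambda>n. flint_hills_term P u v (Suc n))"
    using nonconv summable_LIMSEQ_zero convergent_def by blast
qed

end
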